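(* Let $(X,d)$ be a complete, proper, separable metric space which is a length space, and let $b>0$. For all $\mu_0,\mu_1\in\mathcal P(X)$, $$T_{0,b}(\mu_0,\mu_1)=\begin{cases}C_b\displaystyle\int_X\left(\frac{d\mu_1}{d\mu_0}\right)^q d\mu_0,&\mu_1\ll\mu_0,\\ \infty,&\mu_1\not\ll\mu_0,\end{cases}$$ so that $$\widetilde T_{0,b}(\mu_0,\mu_1)=(q-1)\,D_q(\mu_1\,\|\,\mu_0).$$
   Context: $\mathrm{Lip}_b(X)$ is the Banach space of bounded Lipschitz functions on $X$ and $\mathcal P(X)$ the set of Borel probability measures on $X$. For $b>0$ put $p=e^b$, $q=p/(p-1)$ and $C_b=\frac1q p^{-q/p}=\frac1q p^{1-q}$. $\mathcal E_{0,b}$ is the class of all positive functions $\varphi\in C^1([0,1],\mathrm{Lip}_b(X))$, bounded and bounded away from $0$, satisfying $\partial_s\varphi_s+b\varphi_s\ln\varphi_s\le0$, and $T_{0,b}(\mu_0,\mu_1)=\sup_{\varphi\in\mathcal E_{0,b}}\left[\int_X\varphi_1\,d\mu_1-\int_X\varphi_0\,d\mu_0\right]$, $\widetilde T_{0,b}(\mu_0,\mu_1)=\ln\left(\frac1{C_b}T_{0,b}(\mu_0,\mu_1)\right)$. For $r>1$ the Rényi divergence of order $r$ is $D_r(\mu_1\|\mu_0)=\frac1{r-1}\ln\int_X\left(\frac{d\mu_1}{d\mu_0}\right)^r d\mu_0$ if $\mu_1\ll\mu_0$, and $D_r(\mu_1\|\mu_0)=\infty$ otherwise. *)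

theory Defs
  imports "HOL-Probability.Probability"
begin

section \<open>The Banach space of bounded Lipschitz functions\<close>

definition lipb_set :: "('a::metric_space \<Rightarrow> real) set" where
  "lipb_set = {f. bounded (range f) \<and> (\<exists>L. L-lipschitz_on UNIV f)}"

typedef (overloaded) 'a lipb = "lipb_set :: ('a::metric_space \<Rightarrow> real) set"
  morphisms apply_lipb Lipb
  by (rule exI[of _ "\<lambda>_. 0"]) (auto simp: lipb_set_def intro: lipschitz_on_constant)

declare [[coercion "apply_lipb :: 'a::metric_space lipb \<Rightarrow> 'a \<Rightarrow> real"]]

setup_lifting type_definition_lipb

lemma lipb_eqI: "(\<And>x. apply_lipb f x = apply_lipb g x) \<Longrightarrow> f = g"
  by transfer auto

lemma lipb_setI:
  assumes "\<And>x. \<bar>f x\<bar> \<le> B" "\<And>x y. \<bar>f x - f y\<bar> \<le> L * dist x y"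
  shows "f \<in> lipb_set"
proof -
  have "\<bar>f x - f y\<bar> \<le> max L 0 * dist x y" for x y
    by (rule order_trans[OF assms(2)]) (auto intro: mult_right_mono)
  then have "(max L 0)-lipschitz_on UNIV f"
    by (auto intro!: lipschitz_onI simp: dist_real_def)
  then show ?thesis
    using assms(1) by (auto simp: lipb_set_def intro!: boundedI)
qed

lemma lipb_setE:
  assumes "f \<in> lipb_set"
  obtains B L where "\<And>x. \<bar>f x\<bar> \<le> B" "\<And>x y. \<bar>f x - f y\<bar> \<le> L * dist x y" "0 \<le> B" "0 \<le> L"
proof -
  obtain B where B: "\<And>x. \<bar>f x\<bar> \<le> B"
    using assms by (auto simp: lipb_set_def bounded_iff)
  obtain L where L: "L-lipschitz_on UNIV f"
    using assms by (auto simp: lipb_set_def)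
  have "0 \<le> B" by (rule order_trans[OF abs_ge_zero B])
  moreover have "0 \<le> L" by (rule lipschitz_on_nonneg[OF L])
  moreover have "\<bar>f x - f y\<bar> \<le> L * dist x y" for x y
    using lipschitz_onD[OF L, of x y] by (simp add: dist_real_def)
  ultimately show ?thesis using that B by blast
qed

lemma lipb_set_add: "f \<in> lipb_set \<Longrightarrow> g \<in> lipb_set \<Longrightarrow> (\<lambda>x. f x + g x) \<in> lipb_set"
proof (elim lipb_setE)
  fix B L C M
  assume *: "\<And>x. \<bar>f x\<bar> \<le> B" "\<And>x y. \<bar>f x - f y\<bar> \<le> L * dist x y"
    "\<And>x. \<bar>g x\<bar> \<le> C" "\<And>x y. \<bar>g x - g y\<bar> \<le> M * dist x y"
  show ?thesis
  proof (rule lipb_setI)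
    show "\<bar>f x + g x\<bar> \<le> B + C" for x
      using *(1)[of x] *(3)[of x] by linarith
    show "\<bar>f x + g x - (f y + g y)\<bar> \<le> (L + M) * dist x y" for x y
      using *(2)[of x y] *(4)[of x y] unfolding distrib_right by linarith
  qed
qed

lemma lipb_set_scale: "f \<in> lipb_set \<Longrightarrow> (\<lambda>x. a * f x) \<in> lipb_set" for a :: real
proof (elim lipb_setE)
  fix B L
  assume *: "\<And>x. \<bar>f x\<bar> \<le> B" "\<And>x y. \<bar>f x - f y\<bar> \<le> L * dist x y"
  show ?thesis
  proof (rule lipb_setI)
    show "\<bar>a * f x\<bar> \<le> \<bar>a\<bar> * B" for x
      using *(1)[of x] by (simp add: abs_mult mult_left_mono)
    show "\<bar>a * f x - a * f y\<bar> \<le> (\<bar>a\<bar> * L) * dist x y" for x y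
      using mult_left_mono[OF *(2)[of x y], of "\<bar>a\<bar>"]
      by (simp add: abs_mult[symmetric] right_diff_distrib mult.assoc)
  qed
qed

instantiation lipb :: (metric_space) real_vector
begin

lift_definition uminus_lipb :: "'a lipb \<Rightarrow> 'a lipb" is "\<lambda>f x. - f x"
  using lipb_set_scale[of _ "-1"] by simp

lift_definition plus_lipb :: "'a lipb \<Rightarrow> 'a lipb \<Rightarrow> 'a lipb" is "\<lambda>f g x. f x + g x"
  by (rule lipb_set_add)

lift_definition minus_lipb :: "'a lipb \<Rightarrow> 'a lipb \<Rightarrow> 'a lipb" is "\<lambda>f g x. f x - g x"
  using lipb_set_add lipb_set_scale[of _ "-1"] by fastforce

lift_definition zero_lipb :: "'a lipb" is "\<lambda>_. 0"
  by (auto intro: lipb_setI[of _ 0 0])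

lift_definition scaleR_lipb :: "real \<Rightarrow> 'a lipb \<Rightarrow> 'a lipb" is "\<lambda>a f x. a * f x"
  by (rule lipb_set_scale)

lemmas [simp] =
  uminus_lipb.rep_eq plus_lipb.rep_eq minus_lipb.rep_eq zero_lipb.rep_eq scaleR_lipb.rep_eq

instance
  by standard (auto intro!: lipb_eqI simp: algebra_simps)

end

text \<open>The norm is the sup norm plus the optimal Lipschitz constant. The supremum for the latter
  also runs over the pairs with \<open>x = y\<close>, which contribute \<open>0 / 0 = 0\<close>; this avoids a supremum over
  the empty set when the space is a single point.\<close>

definition sup_lipb :: "'a::metric_space lipb \<Rightarrow> real" where
  "sup_lipb f = (SUP x. \<bar>f x\<bar>)"

definition lip_lipb :: "'a::metric_space lipb \<Rightarrow> real" where
  "lip_lipb f = (SUP (x, y). \<bar>f x - f y\<bar> / dist x y)"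

lemma abs_le_sup_lipb: "\<bar>apply_lipb f x\<bar> \<le> sup_lipb f"
proof -
  obtain B L where "\<And>x. \<bar>f x\<bar> \<le> B" "\<And>x y. \<bar>f x - f y\<bar> \<le> L * dist x y" "0 \<le> B" "0 \<le> L"
    using lipb_setE[OF apply_lipb[of f]] by metis
  then show ?thesis
    unfolding sup_lipb_def by (intro cSUP_upper) (auto intro!: bdd_aboveI)
qed

lemma quotient_le_lip_lipb: "\<bar>apply_lipb f x - apply_lipb f y\<bar> / dist x y \<le> lip_lipb f"
proof -
  obtain B L where L: "\<And>x. \<bar>f x\<bar> \<le> B" "\<And>x y. \<bar>f x - f y\<bar> \<le> L * dist x y" "0 \<le> B" "0 \<le> L"
    using lipb_setE[OF apply_lipb[of f]] by metis
  have "\<bar>f u - f v\<bar> / dist u v \<le> L" for u v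
    using L by (cases "u = v") (auto simp: divide_le_eq)
  then have "bdd_above (range (\<lambda>(x, y). \<bar>f x - f y\<bar> / dist x y))"
    by (auto intro!: bdd_aboveI[of _ L])
  from cSUP_upper[OF UNIV_I this, of "(x, y)"] show ?thesis
    by (simp add: lip_lipb_def)
qed

lemma diff_le_lip_lipb: "\<bar>apply_lipb f x - apply_lipb f y\<bar> \<le> lip_lipb f * dist x y"
  using quotient_le_lip_lipb[of f x y] by (cases "x = y") (simp_all add: divide_le_eq)

lemma sup_lipb_least: "(\<And>x. \<bar>apply_lipb f x\<bar> \<le> B) \<Longrightarrow> sup_lipb f \<le> B"
  unfolding sup_lipb_def by (rule cSUP_least) auto

lemma lip_lipb_least:
  assumes "\<And>x y. \<bar>apply_lipb f x - apply_lipb f y\<bar> \<le> L * dist x y" "0 \<le> L"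
  shows "lip_lipb f \<le> L"
proof -
  have "\<bar>f u - f v\<bar> / dist u v \<le> L" for u v
    using assms by (cases "u = v") (auto simp: divide_le_eq)
  then show ?thesis
    unfolding lip_lipb_def by (intro cSUP_least) auto
qed

lemma sup_lipb_nonneg: "0 \<le> sup_lipb f"
  by (rule order_trans[OF abs_ge_zero abs_le_sup_lipb[of f undefined]])

lemma lip_lipb_nonneg: "0 \<le> lip_lipb f"
  using quotient_le_lip_lipb[of f undefined undefined] by simp

instantiation lipb :: (metric_space) real_normed_vector
begin

definition norm_lipb :: "'a lipb \<Rightarrow> real" where
  "norm_lipb f = sup_lipb f + lip_lipb f"

definition dist_lipb :: "'a lipb \<Rightarrow> 'a lipb \<Rightarrow> real" where
  "dist_lipb f g = norm (f - g)"

definition sgn_lipb :: "'a lipb \<Rightarrow> 'a lipb" where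
  "sgn_lipb f = f /\<^sub>R norm f"

definition uniformity_lipb :: "('a lipb \<times> 'a lipb) filter" where
  "uniformity_lipb = (INF e\<in>{0 <..}. principal {(x, y). dist x y < e})"

definition open_lipb :: "'a lipb set \<Rightarrow> bool" where
  "open_lipb S = (\<forall>x\<in>S. \<forall>\<^sub>F (x', y) in uniformity. x' = x \<longrightarrow> y \<in> S)"

instance
proof
  fix f g :: "'a lipb" and a :: real
  show "dist f g = norm (f - g)" "sgn f = f /\<^sub>R norm f"
    "uniformity = (INF e\<in>{0 <..}. principal {(x :: 'a lipb, y). dist x y < e})"
    by (fact dist_lipb_def sgn_lipb_def uniformity_lipb_def)+
  show "open S = (\<forall>x\<in>S. \<forall>\<^sub>F (x', y) in uniformity. x' = x \<longrightarrow> y \<in> S)" for S :: "'a lipb set"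
    by (fact open_lipb_def)
  show "norm f = 0 \<longleftrightarrow> f = 0"
  proof
    assume "norm f = 0"
    then have "sup_lipb f = 0"
      using sup_lipb_nonneg[of f] lip_lipb_nonneg[of f] unfolding norm_lipb_def by linarith
    then show "f = 0"
      using abs_le_sup_lipb[of f] by (auto intro!: lipb_eqI)
  next
    assume "f = 0"
    then have "sup_lipb f \<le> 0" "lip_lipb f \<le> 0"
      by (auto intro!: sup_lipb_least lip_lipb_least)
    then show "norm f = 0"
      using sup_lipb_nonneg[of f] lip_lipb_nonneg[of f] unfolding norm_lipb_def by linarith
  qed
  have "sup_lipb (f + g) \<le> sup_lipb f + sup_lipb g"
    using abs_le_sup_lipb[of f] abs_le_sup_lipb[of g]
    by (intro sup_lipb_least) (auto intro: order_trans[OF abs_triangle_ineq] add_mono)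
  moreover have "lip_lipb (f + g) \<le> lip_lipb f + lip_lipb g"
  proof (rule lip_lipb_least)
    show "\<bar>(f + g) x - (f + g) y\<bar> \<le> (lip_lipb f + lip_lipb g) * dist x y" for x y
      using diff_le_lip_lipb[of f x y] diff_le_lip_lipb[of g x y]
      unfolding distrib_right plus_lipb.rep_eq by linarith
  qed (simp add: lip_lipb_nonneg)
  ultimately show "norm (f + g) \<le> norm f + norm g"
    unfolding norm_lipb_def by linarith
  have le: "norm (c *\<^sub>R h) \<le> \<bar>c\<bar> * norm h" for c and h :: "'a lipb"
  proof -
    have "sup_lipb (c *\<^sub>R h) \<le> \<bar>c\<bar> * sup_lipb h"
      using abs_le_sup_lipb[of h] by (intro sup_lipb_least) (simp add: abs_mult mult_left_mono)
    moreover have "lip_lipb (c *\<^sub>R h) \<le> \<bar>c\<bar> * lip_lipb h"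
      using mult_left_mono[OF diff_le_lip_lipb[of h], of "\<bar>c\<bar>"]
      by (intro lip_lipb_least)
        (simp_all add: lip_lipb_nonneg mult.assoc abs_mult[symmetric] right_diff_distrib)
    ultimately show ?thesis
      unfolding norm_lipb_def distrib_left by linarith
  qed
  show "norm (a *\<^sub>R f) = \<bar>a\<bar> * norm f"
  proof (cases "a = 0")
    case True
    have "0 \<le> norm (a *\<^sub>R f)"
      unfolding norm_lipb_def by (simp add: sup_lipb_nonneg lip_lipb_nonneg)
    then show ?thesis using le[of a f] True by simp
  next
    case False
    have "norm f \<le> \<bar>inverse a\<bar> * norm (a *\<^sub>R f)"
      using le[of "inverse a" "a *\<^sub>R f"] False by simp
    then have "\<bar>a\<bar> * norm f \<le> norm (a *\<^sub>R f)"
      using False by (simp add: field_simps)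
    then show ?thesis using le[of a f] by simp
  qed
qed

end

instance lipb :: (metric_space) banach
proof
  fix F :: "nat \<Rightarrow> 'a lipb"
  assume cau: "Cauchy F"
  have val: "\<bar>f x\<bar> \<le> norm f" and lip: "\<bar>f x - f y\<bar> \<le> norm f * dist x y" for f :: "'a lipb" and x y
  proof -
    show "\<bar>f x\<bar> \<le> norm f"
      using abs_le_sup_lipb[of f x] lip_lipb_nonneg[of f] unfolding norm_lipb_def by linarith
    have "\<bar>f x - f y\<bar> \<le> lip_lipb f * dist x y" by (rule diff_le_lip_lipb)
    also have "\<dots> \<le> norm f * dist x y"
      by (rule mult_right_mono) (simp_all add: norm_lipb_def sup_lipb_nonneg)
    finally show "\<bar>f x - f y\<bar> \<le> norm f * dist x y" .
  qed
  have "Cauchy (\<lambda>n. F n x)" for x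
  proof (rule metric_CauchyI)
    fix e :: real assume "0 < e"
    then obtain N where "\<forall>m\<ge>N. \<forall>n\<ge>N. dist (F m) (F n) < e"
      using metric_CauchyD[OF cau] by blast
    then have "\<forall>m\<ge>N. \<forall>n\<ge>N. dist (F m x) (F n x) < e"
      using val[of "F m - F n" x for m n] unfolding dist_lipb_def dist_real_def
      by (metis le_less_trans minus_lipb.rep_eq)
    then show "\<exists>N. \<forall>m\<ge>N. \<forall>n\<ge>N. dist (F m x) (F n x) < e" by blast
  qed
  then obtain g where g: "\<And>x. (\<lambda>n. F n x) \<longlonglongrightarrow> g x"
    unfolding Cauchy_convergent_iff convergent_def by metis
  have close: "\<exists>N. \<forall>n\<ge>N. \<forall>x y. \<bar>F n x - g x\<bar> \<le> e \<and>
      \<bar>(F n x - g x) - (F n y - g y)\<bar> \<le> e * dist x y" if e: "0 < e" for e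
  proof -
    obtain N where N: "\<And>m n. m \<ge> N \<Longrightarrow> n \<ge> N \<Longrightarrow> norm (F n - F m) < e"
      using metric_CauchyD[OF cau e] unfolding dist_lipb_def by blast
    have "\<bar>F n x - g x\<bar> \<le> e \<and> \<bar>(F n x - g x) - (F n y - g y)\<bar> \<le> e * dist x y"
      if n: "n \<ge> N" for n x y
    proof
      have 1: "\<bar>F n x - F m x\<bar> \<le> e" if "m \<ge> N" for m
        using val[of "F n - F m" x] N[OF that n] by simp
      show "\<bar>F n x - g x\<bar> \<le> e"
        by (rule LIMSEQ_le_const2[OF tendsto_rabs[OF tendsto_diff[OF tendsto_const g]]])
          (use 1 in blast)
      have 2: "\<bar>(F n x - F m x) - (F n y - F m y)\<bar> \<le> e * dist x y" if "m \<ge> N" for m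
        using order_trans[OF lip[of "F n - F m" x y] mult_right_mono[of _ e "dist x y"]] N[OF that n]
        by simp
      show "\<bar>(F n x - g x) - (F n y - g y)\<bar> \<le> e * dist x y"
        by (rule LIMSEQ_le_const2[OF tendsto_rabs[OF tendsto_diff[OF
              tendsto_diff[OF tendsto_const g] tendsto_diff[OF tendsto_const g]]]])
          (use 2 in blast)
    qed
    then show ?thesis by blast
  qed
  have mem: "(\<lambda>x. F n x - g x) \<in> lipb_set"
    if "\<forall>x y. \<bar>F n x - g x\<bar> \<le> e \<and> \<bar>(F n x - g x) - (F n y - g y)\<bar> \<le> e * dist x y" for n e
    using that by (intro lipb_setI[of _ e e]) blast+
  obtain n where "(\<lambda>x. F n x - g x) \<in> lipb_set"
    using close[of 1] mem by fastforce
  from lipb_set_add[OF apply_lipb[of "F n"] lipb_set_scale[OF this, of "-1"]]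
  have "g \<in> lipb_set" by simp
  then obtain G where G: "g = apply_lipb G"
    by (metis Lipb_inverse)
  have "F \<longlonglongrightarrow> G"
  proof (rule metric_LIMSEQ_I)
    fix e :: real assume "0 < e"
    then obtain N where N: "\<forall>n\<ge>N. \<forall>x y. \<bar>F n x - g x\<bar> \<le> e / 3 \<and>
      \<bar>(F n x - g x) - (F n y - g y)\<bar> \<le> e / 3 * dist x y"
      using close[of "e / 3"] by auto
    have "dist (F n) G < e" if n: "n \<ge> N" for n
    proof -
      have "sup_lipb (F n - G) \<le> e / 3"
        by (rule sup_lipb_least) (use N n G in auto)
      moreover have "lip_lipb (F n - G) \<le> e / 3"
        by (rule lip_lipb_least) (use N n G \<open>0 < e\<close> in auto)
      ultimately show ?thesis
        using \<open>0 < e\<close> unfolding dist_lipb_def norm_lipb_def by linarith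
    qed
    then show "\<exists>N. \<forall>n\<ge>N. dist (F n) G < e" by blast
  qed
  then show "convergent F" by (rule convergentI)
qed


section \<open>Length spaces and Borel probability measures\<close>

definition curve_length :: "(real \<Rightarrow> 'a::metric_space) \<Rightarrow> ereal" where
  "curve_length \<gamma> =
    (SUP (n, t) \<in> {(n :: nat, t :: nat \<Rightarrow> real). mono_on {..n} t \<and> t 0 = 0 \<and> t n = 1}.
      ereal (\<Sum>i<n. dist (\<gamma> (t i)) (\<gamma> (t (Suc i)))))"

text \<open>The infimum over the empty set is \<open>\<infinity>\<close>, so any two points are joined by a curve of finite
  length.\<close>

definition length_space :: "'a::metric_space itself \<Rightarrow> bool" where
  "length_space _ \<longleftrightarrow>
    (\<forall>x y :: 'a. ereal (dist x y) =
      (INF \<gamma> \<in> {\<gamma>. path \<gamma> \<and> pathstart \<gamma> = x \<and> pathfinish \<gamma> = y}. curve_length \<gamma>))"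

definition proper_space :: "'a::metric_space itself \<Rightarrow> bool" where
  "proper_space _ \<longleftrightarrow> (\<forall>(x :: 'a) r. compact (cball x r))"

definition borel_probs :: "'a::topological_space measure set" where
  "borel_probs = {\<mu>. prob_space \<mu> \<and> sets \<mu> = sets borel}"


section \<open>The transport functional\<close>

definition p_exp :: "real \<Rightarrow> real" where
  "p_exp b = exp b"

definition q_exp :: "real \<Rightarrow> real" where
  "q_exp b = p_exp b / (p_exp b - 1)"

definition C_const :: "real \<Rightarrow> real" where
  "C_const b = 1 / q_exp b * p_exp b powr (- (q_exp b / p_exp b))"

lemma C_const_alt: "0 < b \<Longrightarrow> C_const b = 1 / q_exp b * p_exp b powr (1 - q_exp b)"
proof -
  assume "0 < b"
  then have "p_exp b > 1" by (simp add: p_exp_def)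
  then have "- (q_exp b / p_exp b) = 1 - q_exp b"
    by (simp add: q_exp_def field_simps)
  then show ?thesis by (simp add: C_const_def)
qed

text \<open>A curve in \<open>C\<^sup>1([0,1], Lip\<^sub>b(X))\<close> is a function on all of \<open>real\<close> of which only the values on
  \<open>{0..1}\<close> matter; the derivative \<open>\<phi>'\<close> is taken in the norm of \<open>Lip\<^sub>b(X)\<close>, one-sided at the end
  points.\<close>

definition E0 :: "real \<Rightarrow> (real \<Rightarrow> 'a::metric_space lipb) set" where
  "E0 b = {\<phi>.
     (\<exists>\<phi>'.
        (\<forall>s\<in>{0..1}. (\<phi> has_vector_derivative \<phi>' s) (at s within {0..1})) \<and>
        continuous_on {0..1} \<phi>' \<and>
        (\<forall>s\<in>{0..1}. \<forall>x.
          apply_lipb (\<phi>' s) x + b * apply_lipb (\<phi> s) x * ln (apply_lipb (\<phi> s) x) \<le> 0)) \<and>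
     (\<forall>s\<in>{0..1}. \<forall>x. 0 < apply_lipb (\<phi> s) x) \<and>
     (\<exists>m>0. \<exists>M. \<forall>s\<in>{0..1}. \<forall>x. m \<le> apply_lipb (\<phi> s) x \<and> apply_lipb (\<phi> s) x \<le> M)}"

definition T0 :: "real \<Rightarrow> 'a::metric_space measure \<Rightarrow> 'a measure \<Rightarrow> ereal" where
  "T0 b \<mu>0 \<mu>1 =
    (SUP \<phi>\<in>E0 b. ereal ((\<integral>x. apply_lipb (\<phi> 1) x \<partial>\<mu>1) - (\<integral>x. apply_lipb (\<phi> 0) x \<partial>\<mu>0)))"

definition ereal_ln :: "ereal \<Rightarrow> ereal" where
  "ereal_ln x = (if x = \<infinity> then \<infinity> else if x \<le> 0 then - \<infinity> else ereal (ln (real_of_ereal x)))"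

definition T0_tilde :: "real \<Rightarrow> 'a::metric_space measure \<Rightarrow> 'a measure \<Rightarrow> ereal" where
  "T0_tilde b \<mu>0 \<mu>1 = ereal_ln (ereal (1 / C_const b) * T0 b \<mu>0 \<mu>1)"


section \<open>Renyi divergence\<close>

text \<open>The integral of the \<open>r\<close>-th power of the density \<open>d\<mu>1/d\<mu>0\<close>, for \<open>\<mu>1 \<lless> \<mu>0\<close>; it may be \<open>\<infinity>\<close>. For
  sigma-finite \<open>\<mu>1\<close> the density is finite \<open>\<mu>0\<close>-almost everywhere, so passing through \<open>enn2real\<close> (which
  sends \<open>\<infinity>\<close> to \<open>0\<close>) does not change the integral.\<close>

definition density_power_integral :: "real \<Rightarrow> 'a measure \<Rightarrow> 'a measure \<Rightarrow> ereal" where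
  "density_power_integral r \<mu>1 \<mu>0 =
    enn2ereal (\<integral>\<^sup>+ x. ennreal (enn2real (RN_deriv \<mu>0 \<mu>1 x) powr r) \<partial>\<mu>0)"

text \<open>\<open>absolutely_continuous \<mu>0 \<mu>1\<close> is \<open>\<mu>1 \<lless> \<mu>0\<close>.\<close>

definition renyi_divergence :: "real \<Rightarrow> 'a measure \<Rightarrow> 'a measure \<Rightarrow> ereal" where
  "renyi_divergence r \<mu>1 \<mu>0 =
    (if absolutely_continuous \<mu>0 \<mu>1
     then ereal (1 / (r - 1)) * ereal_ln (density_power_integral r \<mu>1 \<mu>0)
     else \<infinity>)"

end

theory Submission
  imports Defs
begin

text \<open>Along a curve of the class, the differential inequality says that \<open>exp (b s) ln (\<phi>\<^sub>s x)\<close> is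
  nonincreasing in \<open>s\<close>. Hence \<open>\<phi>\<^sub>1\<^sup>p \<le> \<phi>\<^sub>0\<close>, where \<open>p = exp b\<close> (\<open>E0_curve_endpoints\<close>). Conversely, every
  bounded Lipschitz \<open>h\<close> that is bounded away from \<open>0\<close> is the end point of a curve of the class with
  \<open>\<phi>\<^sub>0 = h\<^sup>p\<close>, namely \<open>\<phi>\<^sub>s = h\<close> raised to the power \<open>exp (b (1 - s))\<close> (\<open>E0_curve_exists\<close>). So the
  transport functional is the supremum of \<open>\<integral> h d\<mu>\<^sub>1 - \<integral> h\<^sup>p d\<mu>\<^sub>0\<close> over such \<open>h\<close>. As bounded Lipschitz
  functions are dense in \<open>L\<^sup>1\<close> of any finite Borel measure on a Polish space, all bounded measurable
  \<open>h \<ge> 0\<close> give values below the same supremum (\<open>T0_ge_bounded_measurable\<close>).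

  If \<open>\<mu>\<^sub>1\<close> charges a \<open>\<mu>\<^sub>0\<close>-null set \<open>A\<close>, large multiples of the indicator of \<open>A\<close> make the supremum
  infinite. If \<open>\<mu>\<^sub>1\<close> has density \<open>g\<close> with respect to \<open>\<mu>\<^sub>0\<close>, the functional is the \<open>\<mu>\<^sub>0\<close>-integral of
  \<open>g h - h\<^sup>p\<close>, which can be maximised pointwise: Young's inequality bounds the integrand by
  \<open>C\<^sub>b g\<^sup>q\<close>, with equality at \<open>h = (g / p)\<^sup>q\<^sup>-\<^sup>1\<close>. This is the upper bound, and inserting the maximiser for
  the truncated density \<open>min g n\<close> and letting \<open>n\<close> tend to infinity gives the lower bound. The
  statement on the Renyi divergence follows by taking logarithms.\<close>

section \<open>Bounded Lipschitz functions as a Banach algebra\<close>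

lemma abs_apply_le_norm: "\<bar>apply_lipb f x\<bar> \<le> norm f"
  using abs_le_sup_lipb[of f x] lip_lipb_nonneg[of f] unfolding norm_lipb_def by linarith

lemma bounded_linear_apply_lipb: "bounded_linear (\<lambda>f. apply_lipb f x)"
  by (rule bounded_linear_intro[where K = 1]) (auto simp: abs_apply_le_norm)

lemma lipb_set_mult:
  assumes "f \<in> lipb_set" "g \<in> lipb_set"
  shows "(\<lambda>x. f x * g x) \<in> lipb_set"
proof -
  obtain B L where f: "\<And>x. \<bar>f x\<bar> \<le> B" "\<And>x y. \<bar>f x - f y\<bar> \<le> L * dist x y" "0 \<le> B" "0 \<le> L"
    using lipb_setE[OF assms(1)] by metis
  obtain C M where g: "\<And>x. \<bar>g x\<bar> \<le> C" "\<And>x y. \<bar>g x - g y\<bar> \<le> M * dist x y" "0 \<le> C" "0 \<le> M"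
    using lipb_setE[OF assms(2)] by metis
  show ?thesis
  proof (rule lipb_setI)
    show "\<bar>f x * g x\<bar> \<le> B * C" for x
      using f g by (simp add: abs_mult mult_mono)
    show "\<bar>f x * g x - f y * g y\<bar> \<le> (B * M + L * C) * dist x y" for x y
    proof -
      have "f x * g x - f y * g y = f x * (g x - g y) + (f x - f y) * g y"
        by (simp add: algebra_simps)
      also have "\<bar>\<dots>\<bar> \<le> \<bar>f x\<bar> * \<bar>g x - g y\<bar> + \<bar>f x - f y\<bar> * \<bar>g y\<bar>"
        unfolding abs_mult[symmetric] by (rule abs_triangle_ineq)
      also have "\<dots> \<le> B * (M * dist x y) + (L * dist x y) * C"
        using f g by (intro add_mono mult_mono) auto
      finally show ?thesis by (simp add: algebra_simps)
    qed
  qed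
qed

text \<open>The norm is submultiplicative by the product rule for sup norms and Lipschitz constants. With the
  completeness of the space this makes the exponential series available inside it, and with it a curve
  \<open>s \<mapsto> exp (a s f)\<close> whose differentiability in the Lipschitz norm comes for free.\<close>

instantiation lipb :: (metric_space) real_normed_algebra_1
begin

lift_definition times_lipb :: "'a lipb \<Rightarrow> 'a lipb \<Rightarrow> 'a lipb" is "\<lambda>f g x. f x * g x"
  by (rule lipb_set_mult)

lift_definition one_lipb :: "'a lipb" is "\<lambda>_. 1"
  by (auto intro: lipb_setI[of _ 1 0])

lemmas [simp] = times_lipb.rep_eq one_lipb.rep_eq

instance
proof
  show "(0 :: 'a lipb) \<noteq> 1"
    by (metis one_lipb.rep_eq zero_lipb.rep_eq zero_neq_one)
  show "norm (f * g) \<le> norm f * norm g" for f g :: "'a lipb"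
  proof -
    have "sup_lipb (f * g) \<le> sup_lipb f * sup_lipb g"
      by (intro sup_lipb_least)
        (simp add: abs_mult mult_mono abs_le_sup_lipb sup_lipb_nonneg)
    moreover have "lip_lipb (f * g) \<le> sup_lipb f * lip_lipb g + lip_lipb f * sup_lipb g"
    proof (rule lip_lipb_least)
      fix x y
      have "(f * g) x - (f * g) y = f x * (g x - g y) + (f x - f y) * g y"
        by (simp add: algebra_simps)
      also have "\<bar>\<dots>\<bar> \<le> \<bar>f x\<bar> * \<bar>g x - g y\<bar> + \<bar>f x - f y\<bar> * \<bar>g y\<bar>"
        unfolding abs_mult[symmetric] by (rule abs_triangle_ineq)
      also have "\<dots> \<le> sup_lipb f * (lip_lipb g * dist x y) + (lip_lipb f * dist x y) * sup_lipb g"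
        by (intro add_mono mult_mono)
          (auto simp: abs_le_sup_lipb sup_lipb_nonneg lip_lipb_nonneg diff_le_lip_lipb)
      finally show "\<bar>(f * g) x - (f * g) y\<bar>
          \<le> (sup_lipb f * lip_lipb g + lip_lipb f * sup_lipb g) * dist x y"
        by (simp add: algebra_simps)
    qed (simp add: sup_lipb_nonneg lip_lipb_nonneg)
    moreover have "0 \<le> lip_lipb f * lip_lipb g"
      by (simp add: lip_lipb_nonneg)
    ultimately show ?thesis
      unfolding norm_lipb_def by (simp add: algebra_simps)
  qed
  show "norm (1 :: 'a lipb) = 1"
  proof -
    have "lip_lipb (1 :: 'a lipb) = 0"
      using lip_lipb_least[of "1 :: 'a lipb" 0] lip_lipb_nonneg[of "1 :: 'a lipb"] by simp
    then show ?thesis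
      by (simp add: norm_lipb_def sup_lipb_def)
  qed
qed (auto intro!: lipb_eqI simp: algebra_simps)

end

lemma apply_lipb_power: "apply_lipb (f ^ n) x = apply_lipb f x ^ n"
  by (induction n) simp_all

text \<open>Evaluation at a point is a continuous algebra homomorphism, so it commutes with the exponential
  series.\<close>

lemma apply_lipb_exp: "apply_lipb (exp f) x = exp (apply_lipb f x)"
proof -
  have "(\<lambda>n. apply_lipb (f ^ n /\<^sub>R fact n) x) sums apply_lipb (exp f) x"
    by (rule bounded_linear.sums[OF bounded_linear_apply_lipb exp_converges])
  moreover have "(\<lambda>n. apply_lipb (f ^ n /\<^sub>R fact n) x) = (\<lambda>n. apply_lipb f x ^ n /\<^sub>R fact n)"
    by (simp add: apply_lipb_power)
  ultimately show ?thesis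
    using exp_converges[of "apply_lipb f x"] sums_unique2 by metis
qed

section \<open>Reduction to the values at the two ends\<close>

text \<open>Dividing the differential inequality by \<open>\<phi>\<^sub>s x\<close> gives \<open>u' + b u \<le> 0\<close> for \<open>u = ln (\<phi>\<^sub>s x)\<close>, so
  with the integrating factor \<open>exp (b s)\<close> the product \<open>exp (b s) u\<close> is nonincreasing.\<close>

lemma E0_curve_endpoints:
  assumes "\<phi> \<in> E0 b"
  shows "apply_lipb (\<phi> 1) x powr exp b \<le> apply_lipb (\<phi> 0) x"
proof -
  obtain \<phi>' where d: "\<And>s. s \<in> {0..1} \<Longrightarrow> (\<phi> has_vector_derivative \<phi>' s) (at s within {0..1})"
    and le: "\<And>s. s \<in> {0..1} \<Longrightarrow>
      apply_lipb (\<phi>' s) x + b * apply_lipb (\<phi> s) x * ln (apply_lipb (\<phi> s) x) \<le> 0"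
    and pos: "\<And>s. s \<in> {0..1} \<Longrightarrow> 0 < apply_lipb (\<phi> s) x"
    using assms unfolding E0_def by blast
  define u where "u s = exp (b * s) * ln (apply_lipb (\<phi> s) x)" for s
  define u' where "u' s = exp (b * s) / apply_lipb (\<phi> s) x *
     (apply_lipb (\<phi>' s) x + b * apply_lipb (\<phi> s) x * ln (apply_lipb (\<phi> s) x))" for s
  have u: "(u has_real_derivative u' s) (at s within {0..1})" if s: "s \<in> {0..1}" for s
  proof -
    have "((\<lambda>s. apply_lipb (\<phi> s) x) has_real_derivative apply_lipb (\<phi>' s) x) (at s within {0..1})"
      unfolding has_real_derivative_iff_has_vector_derivative
      by (rule bounded_linear.has_vector_derivative[OF bounded_linear_apply_lipb d[OF s]])
    then show ?thesis
      unfolding u_def u'_def using pos[OF s]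
      by (auto intro!: derivative_eq_intros simp: field_simps)
  qed
  have "\<exists>s\<in>{0..1}. u 1 - u 0 = (\<lambda>h. u' s * h) (1 - 0)"
    using u by (intro mvt_very_simple) (auto simp: has_field_derivative_def)
  then obtain s where s: "s \<in> {0..1}" "u 1 - u 0 = u' s" by auto
  have "u' s \<le> 0"
    unfolding u'_def using le[OF s(1)] pos[OF s(1)]
    by (intro mult_nonneg_nonpos) auto
  then have "exp b * ln (apply_lipb (\<phi> 1) x) \<le> ln (apply_lipb (\<phi> 0) x)"
    using s(2) by (simp add: u_def)
  then have "exp (exp b * ln (apply_lipb (\<phi> 1) x)) \<le> apply_lipb (\<phi> 0) x"
    using pos[of 0] by (metis atLeastAtMost_iff exp_le_cancel_iff exp_ln order_refl zero_le_one)
  then show ?thesis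
    using pos[of 1] by (simp add: powr_def)
qed

lemma ln_lipschitz_above:
  fixes x y m :: real
  assumes "0 < m" "m \<le> x" "m \<le> y"
  shows "\<bar>ln x - ln y\<bar> \<le> (1 / m) * \<bar>x - y\<bar>"
proof -
  have *: "ln v - ln w \<le> (1 / m) * \<bar>v - w\<bar>" if "m \<le> v" "m \<le> w" for v w
  proof -
    have "ln v - ln w = ln (v / w)" using that assms by (simp add: ln_div)
    also have "\<dots> \<le> v / w - 1" using that assms by (intro ln_le_minus_one) auto
    also have "\<dots> = (v - w) / w" using that assms by (simp add: field_simps)
    also have "\<dots> \<le> \<bar>v - w\<bar> / w" using that assms by (intro divide_right_mono) auto
    also have "\<dots> \<le> \<bar>v - w\<bar> / m" using that assms by (intro divide_left_mono) auto
    finally show ?thesis by simp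
  qed
  show ?thesis
    using *[OF assms(2,3)] *[OF assms(3,2)] abs_minus_commute[of x y] by simp
qed

text \<open>The curve is \<open>exp (exp (b (1 - s)) ln f)\<close>, which solves the differential inequality with equality.
  The lower bound \<open>m\<close> on \<open>f\<close> is what makes \<open>ln f\<close> bounded below and Lipschitz.\<close>

lemma E0_curve_exists:
  assumes f: "f \<in> lipb_set" and m: "0 < m" "\<And>x. m \<le> f x"
  obtains \<phi> where "\<phi> \<in> E0 b" "\<And>x. apply_lipb (\<phi> 1) x = f x" "\<And>x. apply_lipb (\<phi> 0) x = f x powr exp b"
proof -
  obtain B L where BL: "\<And>x. \<bar>f x\<bar> \<le> B" "\<And>x y. \<bar>f x - f y\<bar> \<le> L * dist x y" "0 \<le> B" "0 \<le> L"
    using lipb_setE[OF f] by metis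
  have fpos: "0 < f x" for x using m(1) m(2)[of x] by linarith
  have "(\<lambda>x. ln (f x)) \<in> lipb_set"
  proof (rule lipb_setI)
    show "\<bar>ln (f x)\<bar> \<le> \<bar>ln m\<bar> + \<bar>ln B\<bar>" for x
    proof -
      have "f x \<le> B" using BL(1)[of x] by simp
      then have "ln (f x) \<le> ln B" using fpos[of x] by simp
      moreover have "ln m \<le> ln (f x)" using m by (simp add: fpos)
      ultimately show ?thesis by linarith
    qed
    show "\<bar>ln (f x) - ln (f y)\<bar> \<le> (1 / m * L) * dist x y" for x y
    proof -
      have "\<bar>ln (f x) - ln (f y)\<bar> \<le> (1 / m) * \<bar>f x - f y\<bar>"
        by (rule ln_lipschitz_above[OF m(1) m(2) m(2)])
      also have "\<dots> \<le> (1 / m) * (L * dist x y)"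
        using m BL(2) by (intro mult_left_mono) auto
      finally show ?thesis by simp
    qed
  qed
  then obtain U where U: "\<And>x. apply_lipb U x = ln (f x)"
    by (metis Lipb_inverse)
  define a where "a s = exp (b * (1 - s))" for s
  define \<phi> where "\<phi> s = exp (a s *\<^sub>R U)" for s
  define \<phi>' where "\<phi>' s = (- b * a s) *\<^sub>R (\<phi> s * U)" for s
  have val: "apply_lipb (\<phi> s) x = exp (a s * ln (f x))" for s x
    by (simp add: \<phi>_def apply_lipb_exp U)
  have da: "(a has_vector_derivative (- b * a s)) (at s within S)" for s S
    unfolding a_def has_real_derivative_iff_has_vector_derivative[symmetric]
    by (auto intro!: derivative_eq_intros)
  have d: "(\<phi> has_vector_derivative \<phi>' s) (at s within {0..1})" for s
    using vector_diff_chain_within[OF da[of s "{0..1}"] exp_scaleR_has_vector_derivative_right[of U "a s"]]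
    unfolding \<phi>_def \<phi>'_def o_def by simp
  have cont: "continuous_on {0..1} \<phi>'"
  proof -
    have "continuous_on {0..1} \<phi>"
      using d has_vector_derivative_continuous continuous_on_eq_continuous_within by blast
    then show ?thesis
      unfolding \<phi>'_def a_def by (intro continuous_intros)
  qed
  have ode: "apply_lipb (\<phi>' s) x + b * apply_lipb (\<phi> s) x * ln (apply_lipb (\<phi> s) x) \<le> 0" for s x
    by (simp add: \<phi>'_def val U)
  define K where "K = exp \<bar>b\<bar> * norm U"
  have "\<bar>a s * ln (f x)\<bar> \<le> K" if "s \<in> {0..1}" for s x
  proof -
    have "b * (1 - s) \<le> \<bar>b\<bar> * 1"
      using that by (intro mult_mono) auto
    then have "a s \<le> exp \<bar>b\<bar>" by (simp add: a_def)
    moreover have "\<bar>ln (f x)\<bar> \<le> norm U" using abs_apply_le_norm[of U x] U by simp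
    moreover have "0 \<le> a s" by (simp add: a_def)
    ultimately show ?thesis unfolding K_def by (simp add: abs_mult mult_mono)
  qed
  then have "\<forall>s\<in>{0..1}. \<forall>x. exp (- K) \<le> apply_lipb (\<phi> s) x \<and> apply_lipb (\<phi> s) x \<le> exp K"
    by (auto simp: val abs_le_iff minus_le_iff)
  then have "\<exists>m>0. \<exists>M. \<forall>s\<in>{0..1}. \<forall>x. m \<le> apply_lipb (\<phi> s) x \<and> apply_lipb (\<phi> s) x \<le> M"
    using exp_gt_zero by blast
  then have "\<phi> \<in> E0 b"
    unfolding E0_def using d cont ode by (auto simp: val)
  moreover have "apply_lipb (\<phi> 1) x = f x" "apply_lipb (\<phi> 0) x = f x powr exp b" for x
    using fpos[of x] by (simp_all add: val a_def powr_def)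
  ultimately show ?thesis using that by blast
qed

section \<open>Density of Lipschitz functions in mean\<close>

lemma lipb_set_borel_measurable: "f \<in> lipb_set \<Longrightarrow> f \<in> borel_measurable borel"
  by (auto simp: lipb_set_def intro!: borel_measurable_continuous_onI
      dest: lipschitz_on_continuous_on)

lemma integrable_bounded_borel:
  fixes k :: "'a::topological_space \<Rightarrow> real"
  assumes "finite_measure \<mu>" "sets \<mu> = sets borel" "k \<in> borel_measurable borel"
    and "\<And>x. 0 \<le> k x" "\<And>x. k x \<le> B"
  shows "integrable \<mu> k"
proof -
  have "k \<in> borel_measurable \<mu>" using assms(2,3) by (simp cong: measurable_cong_sets)
  then show ?thesis
    using assms(4,5) by (intro finite_measure.integrable_const_bound[OF assms(1), where B = B]) auto
qed

lemma lipb_set_integrable: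
  assumes "f \<in> lipb_set" "finite_measure \<nu>" "sets \<nu> = sets borel"
  shows "integrable \<nu> f"
proof -
  obtain B where "\<And>x. \<bar>f x\<bar> \<le> B"
    using assms(1) by (auto simp: lipb_set_def bounded_iff)
  then show ?thesis
    using assms lipb_set_borel_measurable[OF assms(1)] measurable_cong_sets[OF assms(3) refl]
    by (intro finite_measure.integrable_const_bound[where B = B]) auto
qed

lemma lipb_set_clip:
  fixes m M :: real
  assumes "f \<in> lipb_set"
  shows "(\<lambda>x. max m (min (f x) M)) \<in> lipb_set"
proof -
  obtain B L where L: "\<And>x y. \<bar>f x - f y\<bar> \<le> L * dist x y"
    using lipb_setE[OF assms] by metis
  show ?thesis
  proof (rule lipb_setI)
    show "\<bar>max m (min (f x) M)\<bar> \<le> \<bar>m\<bar> + \<bar>M\<bar>" for x by linarith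
    show "\<bar>max m (min (f x) M) - max m (min (f y) M)\<bar> \<le> L * dist x y" for x y
      using L[of x y] by linarith
  qed
qed

text \<open>Membership of \<open>f\<close> in the \<open>L\<^sup>1\<close>-closure of the bounded Lipschitz functions, to be established for all
  integrable \<open>f\<close> by induction over the construction of the integral.\<close>

definition lip_approximable :: "'a::metric_space measure \<Rightarrow> ('a \<Rightarrow> real) \<Rightarrow> bool" where
  "lip_approximable \<nu> f \<longleftrightarrow> (\<forall>e>0. \<exists>h\<in>lipb_set. (\<integral>x. \<bar>f x - h x\<bar> \<partial>\<nu>) < e)"

lemma lip_approximable_lipb: "f \<in> lipb_set \<Longrightarrow> lip_approximable \<nu> f"
  unfolding lip_approximable_def by (auto intro!: bexI[of _ f])

lemma lip_approximable_close:
  assumes fin: "finite_measure \<nu>" "sets \<nu> = sets borel" and f: "integrable \<nu> f"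
    and g: "\<And>e. 0 < e \<Longrightarrow> \<exists>g. integrable \<nu> g \<and> lip_approximable \<nu> g \<and> (\<integral>x. \<bar>f x - g x\<bar> \<partial>\<nu>) < e"
  shows "lip_approximable \<nu> f"
  unfolding lip_approximable_def
proof (intro allI impI)
  fix e :: real assume "0 < e"
  then have e2: "0 < e / 2" by simp
  then obtain g where g: "integrable \<nu> g" "lip_approximable \<nu> g" "(\<integral>x. \<bar>f x - g x\<bar> \<partial>\<nu>) < e / 2"
    using g by blast
  then obtain h where h: "h \<in> lipb_set" "(\<integral>x. \<bar>g x - h x\<bar> \<partial>\<nu>) < e / 2"
    using e2 unfolding lip_approximable_def by blast
  note hi = lipb_set_integrable[OF h(1) fin]
  have "(\<integral>x. \<bar>f x - h x\<bar> \<partial>\<nu>) \<le> (\<integral>x. \<bar>f x - g x\<bar> + \<bar>g x - h x\<bar> \<partial>\<nu>)"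
    using f g(1) hi by (intro integral_mono) (auto intro!: Bochner_Integration.integrable_add)
  also have "\<dots> = (\<integral>x. \<bar>f x - g x\<bar> \<partial>\<nu>) + (\<integral>x. \<bar>g x - h x\<bar> \<partial>\<nu>)"
    using f g(1) hi by (intro Bochner_Integration.integral_add) auto
  also have "\<dots> < e" using g h by simp
  finally show "\<exists>h\<in>lipb_set. (\<integral>x. \<bar>f x - h x\<bar> \<partial>\<nu>) < e" using h(1) by blast
qed

lemma lip_approximable_limit:
  assumes fin: "finite_measure \<nu>" "sets \<nu> = sets borel"
    and f: "integrable \<nu> f" and w: "integrable \<nu> w"
    and s: "\<And>i. integrable \<nu> (s i)" "\<And>i. lip_approximable \<nu> (s i)"
    and lim: "\<And>x. (\<lambda>i. s i x) \<longlonglongrightarrow> f x" and dom: "\<And>i x. \<bar>s i x\<bar> \<le> w x"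
  shows "lip_approximable \<nu> f"
proof (rule lip_approximable_close[OF fin f])
  fix e :: real assume e: "0 < e"
  have "(\<lambda>i. \<integral>x. \<bar>f x - s i x\<bar> \<partial>\<nu>) \<longlonglongrightarrow> (\<integral>x. 0 \<partial>\<nu>)"
  proof (rule integral_dominated_convergence[where w = "\<lambda>x. \<bar>f x\<bar> + w x"])
    show "AE x in \<nu>. (\<lambda>i. \<bar>f x - s i x\<bar>) \<longlonglongrightarrow> 0"
    proof (rule AE_I2)
      show "(\<lambda>i. \<bar>f x - s i x\<bar>) \<longlonglongrightarrow> 0" for x
        using tendsto_rabs[OF tendsto_diff[OF tendsto_const lim], of "f x" x] by simp
    qed
    have "norm \<bar>f x - s i x\<bar> \<le> \<bar>f x\<bar> + w x" for i x
      using dom[of i x] by (auto intro: order_trans[OF abs_triangle_ineq4])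
    then show "AE x in \<nu>. norm \<bar>f x - s i x\<bar> \<le> \<bar>f x\<bar> + w x" for i by simp
  qed (use f s w in auto)
  then have "eventually (\<lambda>i. (\<integral>x. \<bar>f x - s i x\<bar> \<partial>\<nu>) < e) sequentially"
    using e by (intro order_tendstoD(2)) auto
  then obtain i where "(\<integral>x. \<bar>f x - s i x\<bar> \<partial>\<nu>) < e"
    by (auto simp: eventually_sequentially)
  then show "\<exists>g. integrable \<nu> g \<and> lip_approximable \<nu> g \<and> (\<integral>x. \<bar>f x - g x\<bar> \<partial>\<nu>) < e"
    using s by blast
qed

lemma lip_approximable_scale:
  assumes "lip_approximable \<nu> f"
  shows "lip_approximable \<nu> (\<lambda>x. c * f x)"
  unfolding lip_approximable_def
proof (intro allI impI)
  fix e :: real assume "0 < e"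
  then have "0 < e / (\<bar>c\<bar> + 1)" by (intro divide_pos_pos) auto
  then obtain h where h: "h \<in> lipb_set" "(\<integral>x. \<bar>f x - h x\<bar> \<partial>\<nu>) < e / (\<bar>c\<bar> + 1)"
    using assms unfolding lip_approximable_def by blast
  have "(\<integral>x. \<bar>c * f x - c * h x\<bar> \<partial>\<nu>) = \<bar>c\<bar> * (\<integral>x. \<bar>f x - h x\<bar> \<partial>\<nu>)"
    by (simp add: abs_mult flip: right_diff_distrib)
  also have "\<dots> \<le> (\<bar>c\<bar> + 1) * (\<integral>x. \<bar>f x - h x\<bar> \<partial>\<nu>)"
    by (intro mult_right_mono) auto
  also have "\<dots> < e"
    using h(2) by (simp add: field_simps)
  finally show "\<exists>h\<in>lipb_set. (\<integral>x. \<bar>c * f x - h x\<bar> \<partial>\<nu>) < e"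
    using lipb_set_scale[OF h(1), of c] by (intro bexI[of _ "\<lambda>x. c * h x"])
qed

lemma lip_approximable_add:
  assumes fin: "finite_measure \<nu>" "sets \<nu> = sets borel"
    and int: "integrable \<nu> f" "integrable \<nu> g"
    and ap: "lip_approximable \<nu> f" "lip_approximable \<nu> g"
  shows "lip_approximable \<nu> (\<lambda>x. f x + g x)"
  unfolding lip_approximable_def
proof (intro allI impI)
  fix e :: real assume "0 < e"
  then have e2: "0 < e / 2" by simp
  obtain h k where h: "h \<in> lipb_set" "(\<integral>x. \<bar>f x - h x\<bar> \<partial>\<nu>) < e / 2"
    and k: "k \<in> lipb_set" "(\<integral>x. \<bar>g x - k x\<bar> \<partial>\<nu>) < e / 2"
    using ap e2 unfolding lip_approximable_def by blast
  note i = lipb_set_integrable[OF h(1) fin] lipb_set_integrable[OF k(1) fin] int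
  have "(\<integral>x. \<bar>(f x + g x) - (h x + k x)\<bar> \<partial>\<nu>) \<le> (\<integral>x. \<bar>f x - h x\<bar> + \<bar>g x - k x\<bar> \<partial>\<nu>)"
    using i by (intro integral_mono) (auto intro!: Bochner_Integration.integrable_add)
  also have "\<dots> = (\<integral>x. \<bar>f x - h x\<bar> \<partial>\<nu>) + (\<integral>x. \<bar>g x - k x\<bar> \<partial>\<nu>)"
    using i by (intro Bochner_Integration.integral_add) auto
  also have "\<dots> < e" using h k by simp
  finally show "\<exists>h\<in>lipb_set. (\<integral>x. \<bar>f x + g x - h x\<bar> \<partial>\<nu>) < e"
    using lipb_set_add[OF h(1) k(1)] by (intro bexI[of _ "\<lambda>x. h x + k x"])
qed

text \<open>The functions \<open>max 0 (1 - n d(x, K))\<close> are Lipschitz and converge to the indicator of \<open>K\<close> because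
  \<open>d(x, K) > 0\<close> outside the closed set \<open>K\<close>.\<close>

lemma lip_approximable_closed_indicator:
  fixes \<nu> :: "'a::metric_space measure"
  assumes fin: "finite_measure \<nu>" "sets \<nu> = sets borel" and K: "closed K"
  shows "lip_approximable \<nu> (indicator K)"
  \<comment> \<open>The distance to the empty set is \<open>0\<close> by convention, hence the case distinction.\<close>
proof (cases "K = {}")
  case True
  then show ?thesis
    by (intro lip_approximable_lipb) (auto intro: lipb_setI[of _ 0 0])
next
  case False
  interpret finite_measure \<nu> by fact
  define s where "s n x = max 0 (1 - real n * infdist x K)" for n x
  have lip: "s n \<in> lipb_set" for n
  proof (rule lipb_setI)
    show "\<bar>s n x\<bar> \<le> 1" for x unfolding s_def by (simp add: infdist_nonneg)
    show "\<bar>s n x - s n y\<bar> \<le> real n * dist x y" for x y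
    proof -
      have "\<bar>s n x - s n y\<bar> \<le> \<bar>real n * infdist x K - real n * infdist y K\<bar>"
        unfolding s_def by linarith
      also have "\<dots> = real n * \<bar>infdist x K - infdist y K\<bar>"
        by (simp add: abs_mult flip: right_diff_distrib)
      also have "\<dots> \<le> real n * dist x y"
        by (intro mult_left_mono infdist_triangle_abs) auto
      finally show ?thesis .
    qed
  qed
  show ?thesis
  proof (rule lip_approximable_limit[OF fin, where s = s and w = "\<lambda>_. 1"])
    show "integrable \<nu> (indicator K :: 'a \<Rightarrow> real)"
      using K fin by (intro integrable_real_indicator) (auto simp: emeasure_eq_measure)
    show "(\<lambda>n. s n x) \<longlonglongrightarrow> indicator K x" for x
    proof (cases "x \<in> K")
      case True
      then show ?thesis by (simp add: s_def)
    next
      case xK: False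
      then have pos: "0 < infdist x K"
        using K False in_closed_iff_infdist_zero[of K x] infdist_nonneg[of x K] by linarith
      obtain N where N: "1 / infdist x K < real N" using reals_Archimedean2 by blast
      have "s n x = 0" if "n \<ge> N" for n
      proof -
        have "1 / infdist x K < real n" using N that by simp
        then show ?thesis using pos by (simp add: s_def field_simps)
      qed
      then show ?thesis
        using xK by (intro tendsto_eventually) (auto simp: eventually_sequentially)
    qed
    show "\<bar>s i x\<bar> \<le> 1" for i x unfolding s_def by (simp add: infdist_nonneg)
  qed (use lip lip_approximable_lipb lipb_set_integrable[OF _ fin] in auto)
qed

text \<open>Inner regularity of finite Borel measures on a Polish space reduces Borel sets to compact ones.\<close>

lemma lip_approximable_indicator:
  fixes \<nu> :: "'a::polish_space measure"
  assumes fin: "finite_measure \<nu>" "sets \<nu> = sets borel" and A: "A \<in> sets \<nu>"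
  shows "lip_approximable \<nu> (indicator A)"
proof -
  interpret finite_measure \<nu> by fact
  have int: "integrable \<nu> (indicator B :: 'a \<Rightarrow> real)" if "B \<in> sets \<nu>" for B
    using that by (intro integrable_real_indicator) (auto simp: emeasure_eq_measure)
  show ?thesis
  proof (rule lip_approximable_close[OF fin int[OF A]])
    fix e :: real assume e: "0 < e"
    have reg: "emeasure \<nu> A = (SUP K \<in> {K. K \<subseteq> A \<and> compact K}. emeasure \<nu> K)"
      using A fin by (intro inner_regular) (auto simp: emeasure_eq_measure)
    have "\<exists>K. K \<subseteq> A \<and> compact K \<and> measure \<nu> A - e < measure \<nu> K"
    proof (cases "measure \<nu> A - e < 0")
      case True
      then show ?thesis by (intro exI[of _ "{}"]) auto
    next
      case False
      have "ennreal (measure \<nu> A - e) < emeasure \<nu> A"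
        using e False by (simp add: emeasure_eq_measure ennreal_less_iff)
      then obtain K where "K \<subseteq> A" "compact K" "ennreal (measure \<nu> A - e) < emeasure \<nu> K"
        unfolding reg by (auto simp: less_SUP_iff)
      then show ?thesis
        using False by (auto simp: emeasure_eq_measure ennreal_less_iff)
    qed
    then obtain K where K: "K \<subseteq> A" "compact K" "measure \<nu> A - e < measure \<nu> K" by blast
    have Ks: "K \<in> sets \<nu>" using K fin by (auto intro: borel_compact)
    have "\<bar>indicator A x - indicator K x :: real\<bar> = indicator (A - K) x" for x
      using K(1) by (auto simp: indicator_def)
    then have "(\<integral>x. \<bar>indicator A x - indicator K x :: real\<bar> \<partial>\<nu>) = measure \<nu> (A - K)"
      using sets.sets_into_space[OF A] A Ks by (simp add: Int_absorb2 Int_commute Diff_subset)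
    also have "\<dots> < e"
      using finite_measure_Diff[OF A Ks K(1)] K(3) by simp
    finally show "\<exists>g. integrable \<nu> g \<and> lip_approximable \<nu> g \<and> (\<integral>x. \<bar>indicator A x - g x\<bar> \<partial>\<nu>) < e"
      using int[OF Ks] lip_approximable_closed_indicator[OF fin compact_imp_closed[OF K(2)]] by blast
  qed
qed

lemma integrable_imp_lip_approximable:
  fixes \<nu> :: "'a::polish_space measure"
  assumes fin: "finite_measure \<nu>" "sets \<nu> = sets borel" and f: "integrable \<nu> f"
  shows "lip_approximable \<nu> f"
  using f
proof (induction rule: integrable_induct)
  case (base A c)
  then show ?case
    using lip_approximable_scale[OF lip_approximable_indicator[OF fin base(1)], of c]
    by (simp add: mult.commute)
next
  case (add f g)
  then show ?case using lip_approximable_add[OF fin] by blast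
next
  case (lim f s)
  have sp: "space \<nu> = UNIV" using sets_eq_imp_space_eq[OF fin(2)] by simp
  show ?case
    by (rule lip_approximable_limit[OF fin, where s = s and w = "\<lambda>x. 2 * \<bar>f x\<bar>"])
      (use lim sp in auto)
qed

lemma integral_mono_measure_nonneg:
  fixes f :: "'a \<Rightarrow> real"
  assumes "sets \<mu> = sets \<nu>" "\<And>A. A \<in> sets \<nu> \<Longrightarrow> emeasure \<mu> A \<le> emeasure \<nu> A"
    and "integrable \<nu> f" "\<And>x. 0 \<le> f x"
  shows "(\<integral>x. f x \<partial>\<mu>) \<le> (\<integral>x. f x \<partial>\<nu>)"
proof -
  have m: "f \<in> borel_measurable \<mu>"
    using assms(3) measurable_cong_sets[OF assms(1) refl] by auto
  have "\<mu> \<le> \<nu>" using assms by (simp add: le_measure)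
  then have "(\<integral>\<^sup>+x. ennreal (f x) \<partial>\<mu>) \<le> (\<integral>\<^sup>+x. ennreal (f x) \<partial>\<nu>)"
    using assms(1) by (intro nn_integral_mono_measure) auto
  moreover have "(\<integral>\<^sup>+x. ennreal (f x) \<partial>\<nu>) < \<infinity>"
    using assms(3,4) by (simp add: nn_integral_eq_integral)
  ultimately show ?thesis
    using m assms(3,4) by (simp add: integral_eq_nn_integral enn2real_mono)
qed

text \<open>One function has to approximate with respect to both measures at once, so the density is applied to
  their supremum \<open>\<nu>\<close>, a finite measure that dominates both. The values of the approximant are then
  clipped to \<open>[m, M]\<close>. As \<open>f\<close> takes values in \<open>[0, M]\<close>, clipping at \<open>M\<close> does not increase the
  error and clipping at \<open>m\<close> increases it by at most \<open>m \<le> e / 2\<close>.\<close>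

lemma lip_approx_two_measures:
  fixes \<mu>0 \<mu>1 :: "'a::polish_space measure"
  assumes \<mu>: "\<mu>0 \<in> borel_probs" "\<mu>1 \<in> borel_probs"
    and f: "f \<in> borel_measurable borel" "\<And>x. 0 \<le> f x" "\<And>x. f x \<le> M"
    and M: "0 < M" and e: "0 < e"
  obtains h m where "h \<in> lipb_set" "0 < m" "\<And>x. m \<le> h x" "\<And>x. h x \<le> M"
    "(\<integral>x. \<bar>f x - h x\<bar> \<partial>\<mu>0) \<le> e" "(\<integral>x. \<bar>f x - h x\<bar> \<partial>\<mu>1) \<le> e"
proof -
  interpret \<mu>0: prob_space \<mu>0 using \<mu> by (simp add: borel_probs_def)
  interpret \<mu>1: prob_space \<mu>1 using \<mu> by (simp add: borel_probs_def)
  have s: "sets \<mu>0 = sets borel" "sets \<mu>1 = sets borel" using \<mu> by (auto simp: borel_probs_def)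
  define \<nu> where "\<nu> = sup_measure' \<mu>0 \<mu>1"
  have s10: "sets \<mu>1 = sets \<mu>0" using s by simp
  have \<nu>s: "sets \<nu> = sets borel" using s by (simp add: \<nu>_def s10)
  have le: "emeasure \<mu>0 A \<le> emeasure \<nu> A" "emeasure \<mu>1 A \<le> emeasure \<nu> A" if "A \<in> sets \<nu>" for A
    using that s \<nu>s unfolding \<nu>_def
    by (auto intro!: le_emeasure_sup_measure'1 le_emeasure_sup_measure'2)
  have "emeasure \<nu> (space \<nu>)
      = (SUP Y\<in>sets \<mu>0. emeasure \<mu>0 (space \<nu> \<inter> Y) + emeasure \<mu>1 (space \<nu> \<inter> - Y))"
    unfolding \<nu>_def using s10 by (subst emeasure_sup_measure') auto
  also have "\<dots> \<le> 1 + 1"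
    by (intro SUP_least add_mono \<mu>0.emeasure_le_1 \<mu>1.emeasure_le_1)
  also have "\<dots> < \<infinity>" by simp
  finally have fin: "finite_measure \<nu>"
    by (intro finite_measureI) auto
  have fi: "integrable \<nu> f"
    by (rule integrable_bounded_borel[OF fin \<nu>s f])
  then obtain h0 where h0: "h0 \<in> lipb_set" "(\<integral>x. \<bar>f x - h0 x\<bar> \<partial>\<nu>) < e / 2"
    using integrable_imp_lip_approximable[OF fin \<nu>s] e unfolding lip_approximable_def
    by (meson half_gt_zero)
  define m where "m = min (e / 2) M"
  define h where "h x = max m (min (h0 x) M)" for x
  have h: "h \<in> lipb_set" unfolding h_def by (rule lipb_set_clip[OF h0(1)])
  have pt: "\<bar>f x - h x\<bar> \<le> \<bar>f x - h0 x\<bar> + e / 2" for x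
    using f(2)[of x] f(3)[of x] e M unfolding h_def m_def by linarith
  have bd: "(\<integral>x. \<bar>f x - h x\<bar> \<partial>\<mu>) \<le> e"
    if p: "prob_space \<mu>" and \<mu>s: "sets \<mu> = sets borel"
      and le: "\<And>A. A \<in> sets \<nu> \<Longrightarrow> emeasure \<mu> A \<le> emeasure \<nu> A" for \<mu>
  proof -
    interpret prob_space \<mu> by fact
    have fi': "integrable \<mu> f"
      by (rule integrable_bounded_borel[OF finite_measure_axioms \<mu>s f])
    note hi = lipb_set_integrable[OF h finite_measure_axioms \<mu>s]
      and h0i = lipb_set_integrable[OF h0(1) finite_measure_axioms \<mu>s]
    have "(\<integral>x. \<bar>f x - h x\<bar> \<partial>\<mu>) \<le> (\<integral>x. \<bar>f x - h0 x\<bar> + e / 2 \<partial>\<mu>)"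
      using fi' hi h0i pt by (intro integral_mono) auto
    also have "\<dots> = (\<integral>x. \<bar>f x - h0 x\<bar> \<partial>\<mu>) + e / 2"
      using fi' h0i prob_space by (subst Bochner_Integration.integral_add) auto
    also have "(\<integral>x. \<bar>f x - h0 x\<bar> \<partial>\<mu>) \<le> (\<integral>x. \<bar>f x - h0 x\<bar> \<partial>\<nu>)"
      using \<mu>s \<nu>s le fi lipb_set_integrable[OF h0(1) fin \<nu>s]
      by (intro integral_mono_measure_nonneg) auto
    finally show ?thesis using h0(2) by simp
  qed
  show ?thesis
  proof (rule that[OF h])
    show "0 < m" using e M by (simp add: m_def)
    show "m \<le> h x" "h x \<le> M" for x by (auto simp: h_def m_def)
    show "(\<integral>x. \<bar>f x - h x\<bar> \<partial>\<mu>0) \<le> e"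
      by (rule bd[OF \<mu>0.prob_space_axioms s(1) le(1)])
    show "(\<integral>x. \<bar>f x - h x\<bar> \<partial>\<mu>1) \<le> e"
      by (rule bd[OF \<mu>1.prob_space_axioms s(2) le(2)])
  qed
qed

section \<open>Young's inequality and its equality case\<close>

lemma exponents:
  assumes "0 < b"
  shows "1 < p_exp b" "1 < q_exp b" "1 / p_exp b + 1 / q_exp b = 1" "0 < C_const b"
proof -
  show p: "1 < p_exp b" using assms by (simp add: p_exp_def)
  then show q: "1 < q_exp b" by (simp add: q_exp_def field_simps)
  show "1 / p_exp b + 1 / q_exp b = 1" using p by (simp add: q_exp_def field_simps)
  show "0 < C_const b" using p q by (simp add: C_const_def)
qed

text \<open>Young's inequality for the product of \<open>t p\<^sup>1\<^sup>/\<^sup>p\<close> and \<open>g p\<^sup>-\<^sup>1\<^sup>/\<^sup>p\<close>: the scaling turns the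
  coefficient of \<open>t\<^sup>p\<close> into \<open>1\<close> and that of \<open>g\<^sup>q\<close> into \<open>C\<^sub>b\<close>.\<close>

lemma C_const_Young:
  assumes b: "0 < b" and t: "0 \<le> t" and g: "0 \<le> g"
  shows "g * t \<le> t powr p_exp b + C_const b * g powr q_exp b"
proof -
  define p where "p = p_exp b"
  define q where "q = q_exp b"
  have e: "1 < p" "1 < q" "1 / p + 1 / q = 1"
    using exponents[OF b] by (simp_all add: p_def q_def)
  have "g * t = (t * p powr (1 / p)) * (g * p powr (- (1 / p)))"
    using e by (simp add: powr_minus field_simps)
  also have "\<dots> \<le> (t * p powr (1 / p)) powr p / p + (g * p powr (- (1 / p))) powr q / q"
    using e t g by (intro Youngs_inequality) auto
  also have "\<dots> = t powr p + C_const b * g powr q"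
    using e t g by (simp add: powr_mult powr_powr C_const_def p_def[symmetric] q_def[symmetric])
  finally show ?thesis by (simp add: p_def q_def)
qed

text \<open>The maximiser \<open>t\<close> of \<open>g t - t\<^sup>p\<close> is the zero of its derivative \<open>g - p t\<^sup>p\<^sup>-\<^sup>1\<close>, and
  \<open>1 / (p - 1) = q - 1\<close>.\<close>

lemma C_const_Young_equality:
  assumes b: "0 < b" and g: "0 \<le> g"
  defines "t \<equiv> (g / p_exp b) powr (q_exp b - 1)"
  shows "g * t - t powr p_exp b = C_const b * g powr q_exp b"
proof (cases "g = 0")
  case True
  then show ?thesis by (simp add: t_def)
next
  case False
  define p where "p = p_exp b"
  define q where "q = q_exp b"
  define w where "w = g / p"
  have e: "1 < p" "1 < q" "(q - 1) * p = q" "1 / q = (p - 1) / p"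
    using exponents[OF b] by (simp_all add: p_def q_def q_exp_def field_simps)
  have w: "0 < w" and gw: "g = p * w" using e g False by (simp_all add: w_def)
  have t: "t = w powr (q - 1)" by (simp add: t_def w_def p_def q_def)
  have "g * t = p * w powr q"
    using w by (simp add: gw t powr_diff)
  moreover have "t powr p = w powr q"
    by (simp add: t powr_powr e)
  moreover have "C_const b * g powr q = (p - 1) * w powr q"
  proof -
    have "C_const b = (p - 1) / p * (p * p powr (- q))"
      using C_const_alt[OF b] e by (simp add: p_def[symmetric] q_def[symmetric] powr_diff powr_minus field_simps)
    also have "\<dots> = (p - 1) * p powr (- q)" using e by simp
    finally have "C_const b * p powr q = (p - 1) * (p powr (- q) * p powr q)" by simp
    also have "p powr (- q) * p powr q = 1" using e by (simp flip: powr_add)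
    finally show ?thesis
      using e w by (simp add: gw powr_mult flip: mult.assoc)
  qed
  ultimately show ?thesis by (simp add: p_def q_def algebra_simps)
qed

text \<open>The convex function \<open>x \<mapsto> x\<^sup>p\<close> lies above its tangent at \<open>h\<close>, here derived from Young's inequality
  for \<open>f\<close> and \<open>h\<^sup>p\<^sup>-\<^sup>1\<close>, which also covers \<open>f = 0\<close>.\<close>

lemma powr_tangent_le:
  fixes h f p :: real
  assumes p: "1 < p" and h: "0 < h" and f: "0 \<le> f"
  shows "h powr p \<le> f powr p + p * h powr (p - 1) * (h - f)"
proof -
  define q where "q = p / (p - 1)"
  have q: "1 < q" "1 / p + 1 / q = 1" "(p - 1) * q = p" "1 / q = (p - 1) / p"
    using p by (simp_all add: q_def field_simps)
  have "f * h powr (p - 1) \<le> f powr p / p + (h powr (p - 1)) powr q / q"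
    using p q f by (intro Youngs_inequality) auto
  also have "(h powr (p - 1)) powr q / q = h powr p * ((p - 1) / p)"
    using q by (simp add: powr_powr divide_inverse)
  finally have "p * (f * h powr (p - 1)) \<le> p * (f powr p / p + h powr p * ((p - 1) / p))"
    using p by (intro mult_left_mono) auto
  also have "\<dots> = f powr p + (p - 1) * h powr p"
    using p by (simp add: field_simps)
  finally have "p * (f * h powr (p - 1)) \<le> f powr p + (p - 1) * h powr p" .
  moreover have "h powr p = h * h powr (p - 1)"
    using h by (simp add: powr_diff)
  ultimately show ?thesis by (simp add: algebra_simps)
qed

section \<open>The two inequalities\<close>

lemma T0_ge_lipschitz:
  assumes "h \<in> lipb_set" "0 < m" "\<And>x. m \<le> h x"
  shows "ereal ((\<integral>x. h x \<partial>\<mu>1) - (\<integral>x. h x powr p_exp b \<partial>\<mu>0)) \<le> T0 b \<mu>0 \<mu>1"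
proof -
  obtain \<phi> where "\<phi> \<in> E0 b" "\<And>x. apply_lipb (\<phi> 1) x = h x"
      "\<And>x. apply_lipb (\<phi> 0) x = h x powr exp b"
    using E0_curve_exists[OF assms] by metis
  moreover from this have "apply_lipb (\<phi> 1) = h" "apply_lipb (\<phi> 0) = (\<lambda>x. h x powr exp b)"
    by auto
  ultimately show ?thesis
    unfolding T0_def by (intro SUP_upper2[of \<phi>]) (auto simp: p_exp_def)
qed

text \<open>If \<open>h\<close> is close to \<open>f\<close> in mean for both measures and has the same upper bound \<open>N\<close>, then the
  functional at \<open>h\<close> is at least its value at \<open>f\<close> up to a small error: for the \<open>\<mu>\<^sub>1\<close>-term this is
  immediate, and for the \<open>\<mu>\<^sub>0\<close>-term the tangent inequality gives
  \<open>h\<^sup>p \<le> f\<^sup>p + p N\<^sup>p\<^sup>-\<^sup>1 \<bar>f - h\<bar>\<close>.\<close>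

lemma T0_ge_bounded_measurable:
  fixes \<mu>0 \<mu>1 :: "'a::polish_space measure"
  assumes b: "0 < b" and \<mu>: "\<mu>0 \<in> borel_probs" "\<mu>1 \<in> borel_probs"
    and f: "f \<in> borel_measurable borel" "\<And>x. 0 \<le> f x" "\<And>x. f x \<le> M"
  shows "ereal ((\<integral>x. f x \<partial>\<mu>1) - (\<integral>x. f x powr p_exp b \<partial>\<mu>0)) \<le> T0 b \<mu>0 \<mu>1"
proof (rule ereal_le_epsilon2)
  fix e :: real assume e: "0 < e"
  interpret \<mu>0: prob_space \<mu>0 using \<mu> by (simp add: borel_probs_def)
  interpret \<mu>1: prob_space \<mu>1 using \<mu> by (simp add: borel_probs_def)
  have s: "sets \<mu>0 = sets borel" "sets \<mu>1 = sets borel" using \<mu> by (auto simp: borel_probs_def)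
  note bdd0 = integrable_bounded_borel[OF \<mu>0.finite_measure_axioms s(1)]
    and bdd1 = integrable_bounded_borel[OF \<mu>1.finite_measure_axioms s(2)]
  define p where "p = p_exp b"
  have p: "1 < p" using exponents[OF b] by (simp add: p_def)
  \<comment> \<open>The bound \<open>M\<close> may be \<open>0\<close>, whereas the approximant has to be positive.\<close>
  define N where "N = max M 1"
  define K where "K = p * N powr (p - 1)"
  have N: "0 < N" "f x \<le> N" for x using f(3)[of x] by (auto simp: N_def)
  have K: "0 \<le> K" using p by (simp add: K_def)
  define d where "d = e / (K + 1)"
  have d: "0 < d" "d * (K + 1) = e" using e K by (auto simp: d_def)
  obtain h m where h: "h \<in> lipb_set" "0 < m" "\<And>x. m \<le> h x" "\<And>x. h x \<le> N"
    "(\<integral>x. \<bar>f x - h x\<bar> \<partial>\<mu>0) \<le> d" "(\<integral>x. \<bar>f x - h x\<bar> \<partial>\<mu>1) \<le> d"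
    by (rule lip_approx_two_measures[OF \<mu> f(1,2) N(2) N(1) d(1)]) blast
  have hpos: "0 < h x" for x using h(2) h(3)[of x] by linarith
  have hm: "h \<in> borel_measurable borel" by (rule lipb_set_borel_measurable[OF h(1)])
  have i0: "integrable \<mu>0 f" "integrable \<mu>0 h" and i1: "integrable \<mu>1 f" "integrable \<mu>1 h"
    using f(1,2) hm less_imp_le[OF hpos] N(2) h(4) by (auto intro!: bdd0 bdd1)
  have ip: "integrable \<mu>0 (\<lambda>x. f x powr p)" "integrable \<mu>0 (\<lambda>x. h x powr p)"
    using f(1,2) hm less_imp_le[OF hpos] N(2) h(4) p
    by (auto intro!: bdd0[where B = "N powr p"] powr_mono2)
  have "(\<integral>x. f x \<partial>\<mu>1) \<le> (\<integral>x. h x + \<bar>f x - h x\<bar> \<partial>\<mu>1)"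
    using i1 by (intro integral_mono) auto
  also have "\<dots> = (\<integral>x. h x \<partial>\<mu>1) + (\<integral>x. \<bar>f x - h x\<bar> \<partial>\<mu>1)"
    using i1 by (intro Bochner_Integration.integral_add) auto
  finally have 1: "(\<integral>x. f x \<partial>\<mu>1) \<le> (\<integral>x. h x \<partial>\<mu>1) + d" using h(6) by linarith
  have pt: "h x powr p \<le> f x powr p + K * \<bar>f x - h x\<bar>" for x
  proof -
    have "h x powr p \<le> f x powr p + p * h x powr (p - 1) * (h x - f x)"
      by (rule powr_tangent_le[OF p hpos f(2)])
    also have "p * h x powr (p - 1) * (h x - f x) \<le> p * h x powr (p - 1) * \<bar>f x - h x\<bar>"
      using p by (intro mult_left_mono) auto
    also have "\<dots> \<le> K * \<bar>f x - h x\<bar>"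
      unfolding K_def using p hpos[of x] h(4)[of x]
      by (intro mult_right_mono mult_left_mono powr_mono2) auto
    finally show ?thesis by simp
  qed
  have "(\<integral>x. h x powr p \<partial>\<mu>0) \<le> (\<integral>x. f x powr p + K * \<bar>f x - h x\<bar> \<partial>\<mu>0)"
    using i0 ip pt by (intro integral_mono) auto
  also have "\<dots> = (\<integral>x. f x powr p \<partial>\<mu>0) + K * (\<integral>x. \<bar>f x - h x\<bar> \<partial>\<mu>0)"
    using i0 ip by (subst Bochner_Integration.integral_add) auto
  also have "K * (\<integral>x. \<bar>f x - h x\<bar> \<partial>\<mu>0) \<le> K * d"
    using h(5) K by (intro mult_left_mono) auto
  finally have 2: "(\<integral>x. h x powr p \<partial>\<mu>0) \<le> (\<integral>x. f x powr p \<partial>\<mu>0) + K * d" by simp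
  have "(\<integral>x. f x \<partial>\<mu>1) - (\<integral>x. f x powr p \<partial>\<mu>0) \<le> (\<integral>x. h x \<partial>\<mu>1) - (\<integral>x. h x powr p \<partial>\<mu>0) + e"
    using 1 2 d(2) by (simp add: algebra_simps)
  then have "ereal ((\<integral>x. f x \<partial>\<mu>1) - (\<integral>x. f x powr p \<partial>\<mu>0))
      \<le> ereal ((\<integral>x. h x \<partial>\<mu>1) - (\<integral>x. h x powr p \<partial>\<mu>0)) + ereal e"
    by simp
  also have "\<dots> \<le> T0 b \<mu>0 \<mu>1 + ereal e"
    unfolding p_def by (intro add_right_mono T0_ge_lipschitz[OF h(1-3)])
  finally show "ereal ((\<integral>x. f x \<partial>\<mu>1) - (\<integral>x. f x powr p_exp b \<partial>\<mu>0)) \<le> T0 b \<mu>0 \<mu>1 + ereal e"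
    by (simp add: p_def)
qed

text \<open>On a \<open>\<mu>\<^sub>0\<close>-null set \<open>A\<close> with \<open>\<mu>\<^sub>1 A > 0\<close>, the functional at \<open>t\<close> times the indicator of \<open>A\<close> is
  \<open>t \<mu>\<^sub>1 A\<close>.\<close>

lemma T0_eq_infinity_if_not_ac:
  fixes \<mu>0 \<mu>1 :: "'a::polish_space measure"
  assumes b: "0 < b" and \<mu>: "\<mu>0 \<in> borel_probs" "\<mu>1 \<in> borel_probs"
    and nac: "\<not> absolutely_continuous \<mu>0 \<mu>1"
  shows "T0 b \<mu>0 \<mu>1 = \<infinity>"
proof -
  interpret \<mu>1: prob_space \<mu>1 using \<mu> by (simp add: borel_probs_def)
  have s: "sets \<mu>0 = sets borel" "sets \<mu>1 = sets borel" using \<mu> by (auto simp: borel_probs_def)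
  obtain A where A: "A \<in> null_sets \<mu>0" "A \<notin> null_sets \<mu>1"
    using nac by (auto simp: absolutely_continuous_def)
  have As: "A \<in> sets borel" using A(1) s by auto
  define c where "c = measure \<mu>1 A"
  have "c \<noteq> 0" using A(2) As s by (auto simp: null_sets_def \<mu>1.emeasure_eq_measure c_def)
  then have c: "0 < c" by (simp add: c_def zero_less_measure_iff)
  have sp: "space \<mu>1 = UNIV" using sets_eq_imp_space_eq[OF s(2)] by simp
  have *: "ereal (t * c) \<le> T0 b \<mu>0 \<mu>1" if t: "0 \<le> t" for t
  proof -
    define f where "f x = t * indicator A x" for x
    have "(\<integral>x. f x powr p_exp b \<partial>\<mu>0) = (\<integral>x. 0 \<partial>\<mu>0)"
    proof (rule integral_cong_AE)
      show "AE x in \<mu>0. f x powr p_exp b = 0"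
        using AE_not_in[OF A(1)] by eventually_elim (simp add: f_def)
    qed (use As s in \<open>auto simp: f_def\<close>)
    moreover have "(\<integral>x. f x \<partial>\<mu>1) = t * c"
      using As s sp by (simp add: f_def c_def)
    moreover have "f \<in> borel_measurable borel"
      using As unfolding f_def by measurable
    moreover have "0 \<le> f x" "f x \<le> t" for x
      using t by (auto simp: f_def indicator_def)
    ultimately show ?thesis
      using T0_ge_bounded_measurable[OF b \<mu>, of f t] by simp
  qed
  show ?thesis
  proof (rule ereal_top)
    fix B :: real
    have "ereal B \<le> ereal ((\<bar>B\<bar> / c) * c)" using c by simp
    also have "\<dots> \<le> T0 b \<mu>0 \<mu>1" using c by (intro *) auto
    finally show "ereal B \<le> T0 b \<mu>0 \<mu>1" .
  qed
qed

text \<open>The maximiser \<open>(g / p)\<^sup>q\<^sup>-\<^sup>1\<close> need not be bounded, so it is formed with the truncation \<open>min g n\<close>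
  instead of \<open>g\<close>. This loses nothing in the limit, since \<open>g f - f\<^sup>p \<ge> min g n * f - f\<^sup>p\<close> for
  \<open>f \<ge> 0\<close>, and monotone convergence applies even when the integral of \<open>g\<^sup>q\<close> is infinite.\<close>

lemma T0_ge_density_power:
  fixes \<mu>0 \<mu>1 :: "'a::polish_space measure"
  assumes b: "0 < b" and \<mu>: "\<mu>0 \<in> borel_probs" "\<mu>1 \<in> borel_probs"
    and ac: "absolutely_continuous \<mu>0 \<mu>1"
  shows "ereal (C_const b) * density_power_integral (q_exp b) \<mu>1 \<mu>0 \<le> T0 b \<mu>0 \<mu>1"
proof -
  interpret \<mu>0: prob_space \<mu>0 using \<mu> by (simp add: borel_probs_def)
  interpret \<mu>1: prob_space \<mu>1 using \<mu> by (simp add: borel_probs_def)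
  have s: "sets \<mu>0 = sets borel" "sets \<mu>1 = sets borel" using \<mu> by (auto simp: borel_probs_def)
  have s10: "sets \<mu>1 = sets \<mu>0" using s by simp
  note bdd0 = integrable_bounded_borel[OF \<mu>0.finite_measure_axioms s(1)]
    and bdd1 = integrable_bounded_borel[OF \<mu>1.finite_measure_axioms s(2)]
  note meas = measurable_cong_sets[OF s(1) refl] measurable_cong_sets[OF s(2) refl]
  define p where "p = p_exp b"
  define q where "q = q_exp b"
  define C where "C = C_const b"
  have e: "1 < p" "1 < q" "0 < C"
    using exponents[OF b] by (simp_all add: p_def q_def C_def)
  define g where "g x = enn2real (RN_deriv \<mu>0 \<mu>1 x)" for x
  have gm[measurable]: "g \<in> borel_measurable borel"
    using borel_measurable_RN_deriv[of \<mu>0 \<mu>1] unfolding g_def meas by measurable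
  have g0: "0 \<le> g x" for x by (simp add: g_def)
  define gn where "gn n x = min (g x) (real n)" for n x
  have gn0: "0 \<le> gn n x" "gn n x \<le> real n" "gn n x \<le> g x" for n x using g0 by (auto simp: gn_def)
  have gnm[measurable]: "gn n \<in> borel_measurable borel" for n unfolding gn_def by measurable
  have step: "(\<integral>\<^sup>+x. ennreal (C * gn n x powr q) \<partial>\<mu>0) \<le> e2ennreal (T0 b \<mu>0 \<mu>1)" for n
  proof -
    define f where "f x = (gn n x / p) powr (q - 1)" for x
    define M where "M = (real n / p) powr (q - 1)"
    have fm: "f \<in> borel_measurable borel" unfolding f_def by measurable
    have f: "0 \<le> f x" "f x \<le> M" for x
      using gn0[of n x] e by (auto simp: f_def M_def intro!: powr_mono2 divide_right_mono)
    have i1: "integrable \<mu>1 f"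
      using fm f by (rule bdd1)
    have gf: "integrable \<mu>0 (\<lambda>x. g x * f x)" "(\<integral>x. f x \<partial>\<mu>1) = (\<integral>x. g x * f x \<partial>\<mu>0)"
      using \<mu>0.RN_deriv_integrable[OF \<mu>1.sigma_finite_measure_axioms ac s10, of f]
        \<mu>0.RN_deriv_integral[OF \<mu>1.sigma_finite_measure_axioms ac s10, of f] i1 fm meas
      by (auto simp: g_def)
    have ip: "integrable \<mu>0 (\<lambda>x. f x powr p)"
      using fm f e by (intro bdd0[where B = "M powr p"]) (auto intro!: powr_mono2)
    have ig: "integrable \<mu>0 (\<lambda>x. C * gn n x powr q)"
      using gn0[of n] e gnm[of n]
      by (intro bdd0[where B = "C * real n powr q"]) (auto intro!: powr_mono2 mult_left_mono)
    have "(\<integral>x. C * gn n x powr q \<partial>\<mu>0) \<le> (\<integral>x. g x * f x - f x powr p \<partial>\<mu>0)"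
    proof (rule integral_mono[OF ig])
      show "C * gn n x powr q \<le> g x * f x - f x powr p" for x
      proof -
        have "C * gn n x powr q = gn n x * f x - f x powr p"
          using C_const_Young_equality[OF b gn0(1)[of n x]] by (simp add: C_def f_def p_def q_def)
        also have "\<dots> \<le> g x * f x - f x powr p"
          using gn0[of n x] f[of x] by (intro diff_right_mono mult_right_mono) auto
        finally show ?thesis .
      qed
    qed (use gf ip in auto)
    also have "\<dots> = (\<integral>x. f x \<partial>\<mu>1) - (\<integral>x. f x powr p \<partial>\<mu>0)"
      using gf ip by simp
    finally have "ereal (\<integral>x. C * gn n x powr q \<partial>\<mu>0) \<le> T0 b \<mu>0 \<mu>1"
      using T0_ge_bounded_measurable[OF b \<mu> fm f] unfolding p_def
      by (meson ereal_less_eq(3) order_trans)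
    then have "e2ennreal (ereal (\<integral>x. C * gn n x powr q \<partial>\<mu>0)) \<le> e2ennreal (T0 b \<mu>0 \<mu>1)"
      by (rule e2ennreal_mono)
    then show ?thesis
      using ig e by (subst nn_integral_eq_integral) (auto simp: e2ennreal_ereal)
  qed
  have nonneg: "0 \<le> T0 b \<mu>0 \<mu>1"
    using T0_ge_bounded_measurable[OF b \<mu>, of "\<lambda>_. 0" 0] by (simp add: zero_ereal_def)
  have sup: "(SUP n. ennreal (C * gn n x powr q)) = ennreal (C * g x powr q)" for x
  proof (rule antisym)
    show "(SUP n. ennreal (C * gn n x powr q)) \<le> ennreal (C * g x powr q)"
      using gn0[of _ x] e by (intro SUP_least ennreal_leI mult_left_mono powr_mono2) auto
    obtain n where "g x \<le> real n" using real_arch_simple by blast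
    then have "gn n x = g x" by (simp add: gn_def)
    then show "ennreal (C * g x powr q) \<le> (SUP n. ennreal (C * gn n x powr q))"
      by (intro SUP_upper2[of n]) auto
  qed
  have "ennreal C * (\<integral>\<^sup>+x. ennreal (g x powr q) \<partial>\<mu>0) = (\<integral>\<^sup>+x. ennreal (C * g x powr q) \<partial>\<mu>0)"
  proof -
    have "(\<lambda>x. ennreal (g x powr q)) \<in> borel_measurable \<mu>0"
      using gm unfolding meas by measurable
    then show ?thesis
      using e by (subst nn_integral_cmult[symmetric]) (auto simp: ennreal_mult)
  qed
  also have "\<dots> = (\<integral>\<^sup>+x. (SUP n. ennreal (C * gn n x powr q)) \<partial>\<mu>0)"
    by (simp add: sup)
  also have "\<dots> = (SUP n. \<integral>\<^sup>+x. ennreal (C * gn n x powr q) \<partial>\<mu>0)"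
  proof (rule nn_integral_monotone_convergence_SUP)
    show "incseq (\<lambda>n x. ennreal (C * gn n x powr q))"
    proof (intro incseq_SucI le_funI ennreal_leI mult_left_mono powr_mono2)
      show "gn n x \<le> gn (Suc n) x" for n x by (auto simp: gn_def)
    qed (use gn0 e in auto)
    show "(\<lambda>x. ennreal (C * gn n x powr q)) \<in> borel_measurable \<mu>0" for n
      using gnm[of n] unfolding meas by measurable
  qed
  also have "\<dots> \<le> e2ennreal (T0 b \<mu>0 \<mu>1)"
    by (intro SUP_least step)
  finally have "enn2ereal (ennreal C * (\<integral>\<^sup>+x. ennreal (g x powr q) \<partial>\<mu>0)) \<le> T0 b \<mu>0 \<mu>1"
    unfolding less_eq_ennreal.rep_eq enn2ereal_e2ennreal[OF nonneg] .
  then show ?thesis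
    using e by (simp add: density_power_integral_def times_ennreal.rep_eq g_def C_def q_def)
qed

text \<open>Integrating the pointwise Young inequality together with \<open>\<phi>\<^sub>1\<^sup>p \<le> \<phi>\<^sub>0\<close>. The estimate is carried out
  with nonnegative integrals, so that the integral of \<open>g\<^sup>q\<close> may be infinite.\<close>

lemma T0_le_density_power:
  fixes \<mu>0 \<mu>1 :: "'a::polish_space measure"
  assumes b: "0 < b" and \<mu>: "\<mu>0 \<in> borel_probs" "\<mu>1 \<in> borel_probs"
    and ac: "absolutely_continuous \<mu>0 \<mu>1"
  shows "T0 b \<mu>0 \<mu>1 \<le> ereal (C_const b) * density_power_integral (q_exp b) \<mu>1 \<mu>0"
  unfolding T0_def
proof (rule SUP_least)
  fix \<phi> :: "real \<Rightarrow> 'a lipb" assume \<phi>: "\<phi> \<in> E0 b"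
  interpret \<mu>0: prob_space \<mu>0 using \<mu> by (simp add: borel_probs_def)
  interpret \<mu>1: prob_space \<mu>1 using \<mu> by (simp add: borel_probs_def)
  have s: "sets \<mu>0 = sets borel" "sets \<mu>1 = sets borel" using \<mu> by (auto simp: borel_probs_def)
  have s10: "sets \<mu>1 = sets \<mu>0" using s by simp
  note meas = measurable_cong_sets[OF s(1) refl] measurable_cong_sets[OF s(2) refl]
  define p where "p = p_exp b"
  define q where "q = q_exp b"
  define C where "C = C_const b"
  have C: "0 < C" using exponents[OF b] by (simp add: C_def)
  define R where "R = RN_deriv \<mu>0 \<mu>1"
  have Rm[measurable]: "R \<in> borel_measurable \<mu>0" by (simp add: R_def)
  define I where "I = (\<integral>\<^sup>+x. ennreal (enn2real (R x) powr q) \<partial>\<mu>0)"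
  have pos: "0 < apply_lipb (\<phi> 0) x" "0 < apply_lipb (\<phi> 1) x" for x
    using \<phi> by (auto simp: E0_def)
  have int0: "integrable \<mu>0 (\<phi> 0)"
    by (rule lipb_set_integrable[OF apply_lipb \<mu>0.finite_measure_axioms s(1)])
  have int1: "integrable \<mu>1 (\<phi> 1)"
    by (rule lipb_set_integrable[OF apply_lipb \<mu>1.finite_measure_axioms s(2)])
  have "ennreal (\<integral>x. \<phi> 1 x \<partial>\<mu>1) = (\<integral>\<^sup>+x. ennreal (\<phi> 1 x) \<partial>\<mu>1)"
    using int1 pos by (subst nn_integral_eq_integral) (auto intro: less_imp_le)
  also have "\<dots> = (\<integral>\<^sup>+x. R x * ennreal (\<phi> 1 x) \<partial>\<mu>0)"
  proof -
    have "(\<lambda>x. ennreal (\<phi> 1 x)) \<in> borel_measurable \<mu>0"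
      using borel_measurable_integrable[OF int1] unfolding meas by measurable
    then show ?thesis
      unfolding R_def by (rule \<mu>0.RN_deriv_nn_integral[OF ac s10])
  qed
  also have "\<dots> \<le> (\<integral>\<^sup>+x. ennreal (\<phi> 0 x) + ennreal C * ennreal (enn2real (R x) powr q) \<partial>\<mu>0)"
  proof (rule nn_integral_mono_AE)
    have "AE x in \<mu>0. R x \<noteq> \<infinity>"
      unfolding R_def by (rule \<mu>0.RN_deriv_finite[OF \<mu>1.sigma_finite_measure_axioms ac s10])
    then show "AE x in \<mu>0. R x * ennreal (\<phi> 1 x)
        \<le> ennreal (\<phi> 0 x) + ennreal C * ennreal (enn2real (R x) powr q)"
    proof eventually_elim
      case (elim x)
      have "enn2real (R x) * \<phi> 1 x \<le> \<phi> 1 x powr p + C * enn2real (R x) powr q"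
        unfolding p_def q_def C_def using pos[of x] by (intro C_const_Young[OF b]) auto
      also have "\<phi> 1 x powr p \<le> \<phi> 0 x"
        using E0_curve_endpoints[OF \<phi>] by (simp add: p_def p_exp_def)
      finally have *: "enn2real (R x) * \<phi> 1 x \<le> \<phi> 0 x + C * enn2real (R x) powr q" by simp
      have "R x * ennreal (\<phi> 1 x) = ennreal (enn2real (R x) * \<phi> 1 x)"
        using elim by (simp add: ennreal_mult less_imp_le[OF pos(2)] ennreal_enn2real_if)
      also have "\<dots> \<le> ennreal (\<phi> 0 x + C * enn2real (R x) powr q)"
        by (rule ennreal_leI[OF *])
      also have "\<dots> = ennreal (\<phi> 0 x) + ennreal C * ennreal (enn2real (R x) powr q)"
        using C pos[of x] by (simp add: ennreal_plus ennreal_mult)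
      finally show ?case .
    qed
  qed
  also have "\<dots> = (\<integral>\<^sup>+x. ennreal (\<phi> 0 x) \<partial>\<mu>0) + ennreal C * I"
    unfolding I_def using borel_measurable_integrable[OF int0]
    by (subst nn_integral_add) (auto simp: nn_integral_cmult)
  also have "(\<integral>\<^sup>+x. ennreal (\<phi> 0 x) \<partial>\<mu>0) = ennreal (\<integral>x. \<phi> 0 x \<partial>\<mu>0)"
    using int0 pos by (subst nn_integral_eq_integral) (auto intro: less_imp_le)
  finally have le: "ennreal (\<integral>x. \<phi> 1 x \<partial>\<mu>1) \<le> ennreal (\<integral>x. \<phi> 0 x \<partial>\<mu>0) + ennreal C * I" .
  have nn: "0 \<le> (\<integral>x. \<phi> 0 x \<partial>\<mu>0)" "0 \<le> (\<integral>x. \<phi> 1 x \<partial>\<mu>1)"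
    using less_imp_le[OF pos(1)] less_imp_le[OF pos(2)] by simp_all
  have "ereal ((\<integral>x. \<phi> 1 x \<partial>\<mu>1) - (\<integral>x. \<phi> 0 x \<partial>\<mu>0)) \<le> enn2ereal (ennreal C * I)"
  proof (cases "ennreal C * I")
    case (real c)
    then have "ennreal (\<integral>x. \<phi> 1 x \<partial>\<mu>1) \<le> ennreal ((\<integral>x. \<phi> 0 x \<partial>\<mu>0) + c)"
      using le nn by (simp add: ennreal_plus)
    then have "(\<integral>x. \<phi> 1 x \<partial>\<mu>1) \<le> (\<integral>x. \<phi> 0 x \<partial>\<mu>0) + c"
      using real nn by (subst ennreal_le_iff[symmetric]) auto
    then show ?thesis using real by simp
  qed simp
  then show "ereal ((\<integral>x. \<phi> 1 x \<partial>\<mu>1) - (\<integral>x. \<phi> 0 x \<partial>\<mu>0))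
      \<le> ereal (C_const b) * density_power_integral (q_exp b) \<mu>1 \<mu>0"
    using C by (simp add: density_power_integral_def times_ennreal.rep_eq I_def C_def q_def R_def)
qed

theorem proposition5p11:
  fixes \<mu>0 \<mu>1 :: "'a::polish_space measure" and b :: real
  assumes "proper_space TYPE('a)"
    and "length_space TYPE('a)"
    and "0 < b"
    and "\<mu>0 \<in> borel_probs"
    and "\<mu>1 \<in> borel_probs"
  shows "T0 b \<mu>0 \<mu>1 =
      (if absolutely_continuous \<mu>0 \<mu>1
       then ereal (C_const b) * density_power_integral (q_exp b) \<mu>1 \<mu>0
       else \<infinity>)
    \<and> T0_tilde b \<mu>0 \<mu>1 = ereal (q_exp b - 1) * renyi_divergence (q_exp b) \<mu>1 \<mu>0"
proof -
  note e = exponents[OF assms(3)]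
  show ?thesis
  proof (cases "absolutely_continuous \<mu>0 \<mu>1")
    case True
    have T: "T0 b \<mu>0 \<mu>1 = ereal (C_const b) * density_power_integral (q_exp b) \<mu>1 \<mu>0"
      using T0_le_density_power[OF assms(3-5) True] T0_ge_density_power[OF assms(3-5) True]
      by (rule antisym)
    have cancel: "ereal (1 / c) * (ereal c * y) = y" "ereal c * (ereal (1 / c) * y) = y"
      if "0 < c" for c y
      using that by (simp_all add: mult.assoc[symmetric] one_ereal_def[symmetric])
    have "0 < q_exp b - 1" using e(2) by simp
    from cancel(2)[OF this] show ?thesis
      unfolding T0_tilde_def renyi_divergence_def if_P[OF True] T cancel(1)[OF e(4)] by simp
  next
    case False
    have T: "T0 b \<mu>0 \<mu>1 = \<infinity>"
      by (rule T0_eq_infinity_if_not_ac[OF assms(3-5) False])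
    show ?thesis
      using False e T by (simp add: T0_tilde_def renyi_divergence_def ereal_ln_def)
  qed
qed

end
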